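(* Let $(u_i)_{i=0}^{\infty}$ be any sequence of real numbers. Then there exist two non-decreasing real sequences $(v_i)_{i=0}^{\infty}$ and $(w_i)_{i=0}^{\infty}$ such that $u_i=v_i-w_i$ for all $i\ge 0$, where $(v_i)$ is a majorant of $(u_i)$ (that is, $v_i\ge u_i$ for all $i\ge 0$) and $(w_i)$ is non-negative (that is, $w_i\ge 0$ for all $i\ge 0$). *)

theory Defs
  imports Complex_Main
begin

end

theory Submission imports Defs begin

text \<open>
  This is the Jordan decomposition of a function of bounded variation, in discrete form. A real
  sequence has finite total variation on every initial segment, and this variation grows from
  each index to the next by the size of the jump there. Adding it to the sequence therefore
  cancels every downward jump.
\<close>

theorem proposition1p3:
  fixes u :: "nat \<Rightarrow> real"
  shows "\<exists>v w :: nat \<Rightarrow> real.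
           incseq v \<and> incseq w \<and>
           (\<forall>i. u i = v i - w i) \<and>
           (\<forall>i. v i \<ge> u i) \<and>
           (\<forall>i. w i \<ge> 0)"
proof -
  define w where "w i = (\<Sum>k<i. \<bar>u (Suc k) - u k\<bar>)" for i
  define v where "v i = u i + w i" for i
  have w_Suc: "w (Suc i) = w i + \<bar>u (Suc i) - u i\<bar>" for i
    by (simp add: w_def)
  have "incseq w"
    by (rule incseq_SucI) (simp add: w_Suc)
  moreover have "incseq v"
    by (rule incseq_SucI) (simp add: v_def w_Suc)
  moreover have "w i \<ge> 0" for i
    by (simp add: w_def sum_nonneg)
  ultimately show ?thesis
    by (intro exI[of _ v] exI[of _ w]) (simp add: v_def)
qed

end
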